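(* Let $T$ be a strong Kurepa tree. Then $T$ contains an Aronszajn subtree.
   Context: An $\omega_1$-tree is a tree of height $\omega_1$ all of whose levels are countable. A Kurepa tree is an $\omega_1$-tree with at least $\omega_2$-many cofinal branches. An Aronszajn tree is an $\omega_1$-tree with no cofinal branch; an Aronszajn subtree of $T$ is a subset of $T$ which, with the order inherited from $T$, is an Aronszajn tree. $[T]$ is the set of all cofinal branches of $T$ (downwards closed chains meeting every level), with the cone topology, whose basic open sets are $\{ b \in [T] : x \in b \}$ for $x \in T$. ${}^{\omega_1}2$ is the set of functions from $\omega_1$ to $2$, with the cone topology, whose basic open sets are $\{ h \in {}^{\omega_1}2 : s \subseteq h \}$ for $s \in {}^{<\omega_1}2= \bigcup_{\alpha<\omega_1} {}^{\alpha}2$. A strong Kurepa tree is a Kurepa tree $T$ such that ${}^{\omega_1}2$ is a continuous image of $[T]$ with respect to the cone topologies, i.e. there is a continuous surjection $[T] \to {}^{\omega_1}2$. *)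

theory Defs
  imports "HOL-Analysis.Analysis"
begin

unbundle cardinal_syntax

text \<open>
  Trees are given by their non-strict order relation \<open>r\<close>; the underlying set is \<open>Field r\<close>.
  Ordinals are well-order relations: \<open>omega1\<close> is the first uncountable one, and the countable
  ordinals are its proper initial segments \<open>Restr omega1 (underS omega1 a)\<close> for
  \<open>a \<in> Field omega1\<close>.
\<close>

definition omega1 :: "nat set rel" where
  "omega1 = cardSuc natLeq"

definition omega2 :: "nat set set rel" where
  "omega2 = cardSuc omega1"

definition tree :: "'a rel \<Rightarrow> bool" where
  "tree r \<longleftrightarrow> Partial_order r \<and> (\<forall>x\<in>Field r. Well_order (Restr r (underS r x)))"

definition level :: "'a rel \<Rightarrow> 'b rel \<Rightarrow> 'a set" where
  "level r w = {x \<in> Field r. (Restr r (underS r x), w) \<in> ordIso}"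

text \<open>The height of a tree is the least ordinal whose level is empty.\<close>

definition has_height :: "'a rel \<Rightarrow> 'b rel \<Rightarrow> bool" where
  "has_height r w \<longleftrightarrow> Well_order w \<and> level r w = {} \<and>
     (\<forall>a\<in>Field w. level r (Restr w (underS w a)) \<noteq> {})"

definition omega1_tree :: "'a rel \<Rightarrow> bool" where
  "omega1_tree r \<longleftrightarrow> tree r \<and> has_height r omega1 \<and>
     (\<forall>a\<in>Field omega1. countable (level r (Restr omega1 (underS omega1 a))))"

definition cofinal_branches :: "'a rel \<Rightarrow> 'a set set" where
  "cofinal_branches r = {b \<in> Chains r. (\<forall>x\<in>b. under r x \<subseteq> b) \<and>
     (\<forall>a\<in>Field omega1. b \<inter> level r (Restr omega1 (underS omega1 a)) \<noteq> {})}"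

definition kurepa_tree :: "'a rel \<Rightarrow> bool" where
  "kurepa_tree r \<longleftrightarrow> omega1_tree r \<and> omega2 \<le>o |cofinal_branches r|"

definition aronszajn_tree :: "'a rel \<Rightarrow> bool" where
  "aronszajn_tree r \<longleftrightarrow> omega1_tree r \<and> cofinal_branches r = {}"

text \<open>Subtrees need not be downwards closed; their levels are computed in the induced order.\<close>

definition aronszajn_subtree :: "'a set \<Rightarrow> 'a rel \<Rightarrow> bool" where
  "aronszajn_subtree S r \<longleftrightarrow> S \<subseteq> Field r \<and> aronszajn_tree (Restr r S)"

definition branch_topology :: "'a rel \<Rightarrow> 'a set topology" where
  "branch_topology r = topology_generated_by {{b \<in> cofinal_branches r. x \<in> b} | x. x \<in> Field r}"

definition cantor_space :: "(nat set \<Rightarrow> bool) set" where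
  "cantor_space = Field omega1 \<rightarrow>\<^sub>E (UNIV :: bool set)"

definition cantor_topology :: "(nat set \<Rightarrow> bool) topology" where
  "cantor_topology = topology_generated_by
     {{h \<in> cantor_space. \<forall>c\<in>underS omega1 a. h c = s c} | a s.
        a \<in> Field omega1 \<and> s \<in> underS omega1 a \<rightarrow>\<^sub>E (UNIV :: bool set)}"

definition strong_kurepa_tree :: "'a rel \<Rightarrow> bool" where
  "strong_kurepa_tree r \<longleftrightarrow> kurepa_tree r \<and>
     (\<exists>f. continuous_map (branch_topology r) cantor_topology f \<and>
          f ` cofinal_branches r = cantor_space)"

lemma Field_omega1_nonempty: "Field omega1 \<noteq> {}"
proof -
  have "infinite (Field omega1)"
    unfolding omega1_def using cardSuc_finite[OF natLeq_Card_order] by (simp add: Field_natLeq)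
  then show ?thesis
    by auto
qed

lemma topspace_branch_topology: "topspace (branch_topology r) = cofinal_branches r"
proof
  show "topspace (branch_topology r) \<subseteq> cofinal_branches r"
    unfolding branch_topology_def topology_generated_by_topspace by auto
  obtain a where a: "a \<in> Field omega1"
    using Field_omega1_nonempty by auto
  show "cofinal_branches r \<subseteq> topspace (branch_topology r)"
  proof
    fix b assume b: "b \<in> cofinal_branches r"
    then have "b \<inter> level r (Restr omega1 (underS omega1 a)) \<noteq> {}"
      using a unfolding cofinal_branches_def by auto
    then obtain x where "x \<in> b" "x \<in> Field r"
      unfolding level_def by auto
    then show "b \<in> topspace (branch_topology r)"
      unfolding branch_topology_def topology_generated_by_topspace using b by auto
  qed
qed

lemma topspace_cantor_topology: "topspace cantor_topology = cantor_space"
proof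
  show "topspace cantor_topology \<subseteq> cantor_space"
    unfolding cantor_topology_def topology_generated_by_topspace by auto
  obtain a where a: "a \<in> Field omega1"
    using Field_omega1_nonempty by auto
  show "cantor_space \<subseteq> topspace cantor_topology"
  proof
    fix h assume h: "h \<in> cantor_space"
    define s where "s = restrict h (underS omega1 a)"
    have s: "s \<in> underS omega1 a \<rightarrow>\<^sub>E (UNIV :: bool set)" "\<forall>c\<in>underS omega1 a. h c = s c"
      unfolding s_def by simp_all
    show "h \<in> topspace cantor_topology"
      unfolding cantor_topology_def topology_generated_by_topspace
      by (rule UnionI[of "{g \<in> cantor_space. \<forall>c\<in>underS omega1 a. g c = s c}"])
        (use a h s in blast)+
  qed
qed

end

theory Submission
  imports Defs
begin

text \<open>
  Let \<open>f\<close> be a continuous surjection from the cofinal branches of \<open>T\<close> onto the space of binary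
  sequences of length \<open>\<omega>\<^sub>1\<close>. Fix an infinite ordinal \<open>a < \<omega>\<^sub>1\<close> and look only at the digits of
  \<open>f b\<close> at places below \<open>a\<close>. Say that a node \<open>x\<close> decides these digits if they are the same for all
  cofinal branches \<open>b\<close> through \<open>x\<close>. The Aronszajn subtree is the set of nodes that do not decide
  them. It is downward closed, so its levels are the traces of the levels of \<open>T\<close>, and its cofinal
  branches are cofinal branches of \<open>T\<close> (\<open>aronszajn_subtree_downward_closed\<close>).

  It has no cofinal branch, because by continuity every cofinal branch of \<open>T\<close> contains a deciding
  node (\<open>openin_branch_topology_imp_cone\<close>). It meets every level: a level is countable and every
  cofinal branch passes through it, so if all of its nodes were deciding, only countably many
  sequences of digits below \<open>a\<close> would occur. But \<open>f\<close> is surjective, so all of them occur, and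
  there are uncountably many (\<open>uncountable_cantor_space_restrictions\<close>).
\<close>

text \<open>
  The basic sets already form a base, not merely a subbase: two nodes of a branch are comparable,
  and the cone of the larger one lies inside the cone of the smaller one.
\<close>

lemma openin_branch_topology_imp_cone:
  assumes U: "openin (branch_topology r) U" and b: "b \<in> cofinal_branches r" "b \<in> U"
  shows "\<exists>x\<in>b. {b' \<in> cofinal_branches r. x \<in> b'} \<subseteq> U"
proof -
  have "generate_topology_on {{b \<in> cofinal_branches r. x \<in> b} | x. x \<in> Field r} U"
    using U unfolding branch_topology_def by (simp add: openin_topology_generated_by_iff)
  then have "b \<in> U \<longrightarrow> (\<exists>x\<in>b. {b' \<in> cofinal_branches r. x \<in> b'} \<subseteq> U)"
  proof induction
    case (Int A B)
    show ?case
    proof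
      assume "b \<in> A \<inter> B"
      then obtain x y where x: "x \<in> b" "{b' \<in> cofinal_branches r. x \<in> b'} \<subseteq> A"
        and y: "y \<in> b" "{b' \<in> cofinal_branches r. y \<in> b'} \<subseteq> B"
        using Int.IH by blast
      have mono: "{b' \<in> cofinal_branches r. v \<in> b'} \<subseteq> {b' \<in> cofinal_branches r. u \<in> b'}"
        if "(u, v) \<in> r" for u v
        using that unfolding cofinal_branches_def under_def by blast
      have "(x, y) \<in> r \<or> (y, x) \<in> r"
        using b(1) x(1) y(1) unfolding cofinal_branches_def Chains_def by blast
      then show "\<exists>z\<in>b. {b' \<in> cofinal_branches r. z \<in> b'} \<subseteq> A \<inter> B"
        using x y mono by (meson le_inf_iff order_trans)
    qed
  next
    case (UN K)
    then show ?case by blast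
  next
    case (Basis s)
    then show ?case by blast
  qed simp
  then show ?thesis using b(2) by blast
qed

text \<open>Since \<open>\<omega> < \<omega>\<^sub>1\<close>, some initial segment of \<open>\<omega>\<^sub>1\<close> has order type \<open>\<omega>\<close>.\<close>

lemma infinite_initial_segment_omega1:
  "\<exists>a\<in>Field omega1. infinite (underS omega1 a)"
proof -
  have "natLeq <o omega1"
    unfolding omega1_def by (rule cardSuc_greater[OF natLeq_Card_order])
  moreover have wo: "Well_order omega1"
    unfolding omega1_def
    using cardSuc_Card_order[OF natLeq_Card_order] by (simp add: card_order_on_def)
  ultimately obtain a where a: "a \<in> Field omega1"
    and iso: "natLeq =o Restr omega1 (underS omega1 a)"
    using ordLess_iff_ordIso_Restr[OF wo natLeq_Well_order] by blast
  obtain g where "iso natLeq (Restr omega1 (underS omega1 a)) g"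
    using iso unfolding ordIso_def by blast
  then have "bij_betw g UNIV (Field (Restr omega1 (underS omega1 a)))"
    by (simp add: iso_def Field_natLeq)
  then have "infinite (Field (Restr omega1 (underS omega1 a)))"
    using bij_betw_finite infinite_UNIV_nat by blast
  moreover have "Field (Restr omega1 (underS omega1 a)) \<subseteq> underS omega1 a"
    unfolding Field_def by auto
  ultimately show ?thesis
    using a finite_subset by blast
qed

lemma uncountable_Pow:
  assumes "infinite U"
  shows "uncountable (Pow U)"
proof
  assume "countable (Pow U)"
  then have "|Pow U| \<le>o |UNIV :: nat set|"
    unfolding countable_def card_of_ordLeq[symmetric] by blast
  moreover have "|UNIV :: nat set| \<le>o |U|"
    using assms infinite_iff_card_of_nat by blast
  ultimately have "|Pow U| \<le>o |U|"
    by (rule ordLeq_transitive)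
  then show False
    using card_of_Pow[of U] not_ordLess_ordLeq by blast
qed

lemma uncountable_cantor_space_restrictions:
  assumes "infinite (underS omega1 a)"
  shows "uncountable ((\<lambda>h. restrict h (underS omega1 a)) ` cantor_space)"
proof
  let ?U = "underS omega1 a"
  assume "countable ((\<lambda>h. restrict h ?U) ` cantor_space)"
  then have "countable ((\<lambda>s. {c \<in> ?U. s c}) ` (\<lambda>h. restrict h ?U) ` cantor_space)"
    by (rule countable_image)
  moreover have "Pow ?U \<subseteq> (\<lambda>s. {c \<in> ?U. s c}) ` (\<lambda>h. restrict h ?U) ` cantor_space"
  proof
    fix X assume X: "X \<in> Pow ?U"
    let ?h = "restrict (\<lambda>c. c \<in> X) (Field omega1)"
    have "?h \<in> cantor_space" unfolding cantor_space_def by simp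
    moreover have "?U \<subseteq> Field omega1" by (rule Order_Relation.underS_Field)
    then have "X = {c \<in> ?U. restrict ?h ?U c}" using X by auto
    ultimately show "X \<in> (\<lambda>s. {c \<in> ?U. s c}) ` (\<lambda>h. restrict h ?U) ` cantor_space"
      by blast
  qed
  ultimately show False
    using uncountable_Pow[OF assms] countable_subset by blast
qed

lemma Restr_underS_downward_closed:
  assumes "\<And>x y. (x, y) \<in> r \<Longrightarrow> y \<in> S \<Longrightarrow> x \<in> S" "x \<in> S"
  shows "Restr (Restr r S) (underS (Restr r S) x) = Restr r (underS r x)"
  using assms unfolding underS_def by blast

text \<open>
  Predecessor sets do not change in a downward closed subset, so neither do the heights of nodes.
\<close>

lemma level_Restr_downward_closed:
  assumes "Refl r" "S \<subseteq> Field r"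
    and down: "\<And>x y. (x, y) \<in> r \<Longrightarrow> y \<in> S \<Longrightarrow> x \<in> S"
  shows "level (Restr r S) w = S \<inter> level r w"
proof -
  have "Field (Restr r S) = S"
    using assms(1,2) by (simp add: Refl_Field_Restr2)
  moreover have "Restr (Restr r S) (underS (Restr r S) x) = Restr r (underS r x)" if "x \<in> S" for x
    using down that by (rule Restr_underS_downward_closed)
  ultimately show ?thesis
    unfolding level_def using assms(2) by auto
qed

lemma aronszajn_subtree_downward_closed:
  assumes T: "omega1_tree T" and sub: "S \<subseteq> Field T"
    and down: "\<And>x y. (x, y) \<in> T \<Longrightarrow> y \<in> S \<Longrightarrow> x \<in> S"
    and meets: "\<And>a. a \<in> Field omega1 \<Longrightarrow>
      S \<inter> level T (Restr omega1 (underS omega1 a)) \<noteq> {}"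
    and nobranch: "\<And>b. b \<in> cofinal_branches T \<Longrightarrow> \<not> b \<subseteq> S"
  shows "aronszajn_subtree S T"
proof -
  have po: "Partial_order T"
    and wo: "\<And>x. x \<in> Field T \<Longrightarrow> Well_order (Restr T (underS T x))"
    and ht: "has_height T omega1"
    and cnt: "\<And>a. a \<in> Field omega1 \<Longrightarrow>
      countable (level T (Restr omega1 (underS omega1 a)))"
    using T unfolding omega1_tree_def tree_def by auto
  have refl: "Refl T"
    using po by (simp add: partial_order_on_def preorder_on_def)
  have F: "Field (Restr T S) = S"
    using refl sub by (simp add: Refl_Field_Restr2)
  have R: "Restr (Restr T S) (underS (Restr T S) x) = Restr T (underS T x)" if "x \<in> S" for x
    using down that by (rule Restr_underS_downward_closed)
  have L: "level (Restr T S) w = S \<inter> level T w" for w :: "nat set rel"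
    using refl sub down by (rule level_Restr_downward_closed)
  have "Partial_order (Restr T S)"
    using po by (rule Partial_order_Restr)
  then have "tree (Restr T S)"
    unfolding tree_def F using R wo sub by auto
  moreover have "has_height (Restr T S) omega1"
    using ht meets unfolding has_height_def L by blast
  ultimately have "omega1_tree (Restr T S)"
    unfolding omega1_tree_def L using cnt by auto
  moreover have "cofinal_branches (Restr T S) = {}"
  proof (rule equals0I)
    fix b assume b: "b \<in> cofinal_branches (Restr T S)"
    then have "b \<subseteq> S"
      unfolding cofinal_branches_def Chains_def by blast
    moreover have "b \<in> cofinal_branches T"
      unfolding cofinal_branches_def
    proof (intro CollectI conjI ballI)
      show "b \<in> Chains T"
        using b unfolding cofinal_branches_def Chains_def by blast
    next
      fix x assume "x \<in> b"
      then have "under T x \<subseteq> under (Restr T S) x"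
        using \<open>b \<subseteq> S\<close> down unfolding under_def by blast
      then show "under T x \<subseteq> b"
        using b \<open>x \<in> b\<close> unfolding cofinal_branches_def by blast
    next
      fix a assume "a \<in> Field omega1"
      then show "b \<inter> level T (Restr omega1 (underS omega1 a)) \<noteq> {}"
        using b unfolding cofinal_branches_def L by blast
    qed
    ultimately show False
      using nobranch by blast
  qed
  ultimately show ?thesis
    unfolding aronszajn_subtree_def aronszajn_tree_def using sub by blast
qed

theorem corollary2p11:
  fixes T :: "'a rel"
  assumes "strong_kurepa_tree T"
  shows "\<exists>S. aronszajn_subtree S T"
proof -
  have T: "omega1_tree T"
    using assms unfolding strong_kurepa_tree_def kurepa_tree_def by blast
  obtain f where cont: "continuous_map (branch_topology T) cantor_topology f"
    and surj: "f ` cofinal_branches T = cantor_space"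
    using assms unfolding strong_kurepa_tree_def by blast
  obtain a where a: "a \<in> Field omega1" and inf: "infinite (underS omega1 a)"
    using infinite_initial_segment_omega1 by blast
  define digits where "digits b = restrict (f b) (underS omega1 a)" for b
  define cone where "cone x = {b \<in> cofinal_branches T. x \<in> b}" for x
  define S where "S = {x \<in> Field T. \<exists>b\<in>cone x. \<exists>b'\<in>cone x. digits b \<noteq> digits b'}"
  have "aronszajn_subtree S T"
  proof (rule aronszajn_subtree_downward_closed[OF T])
    show "S \<subseteq> Field T"
      unfolding S_def by blast
  next
    fix x y assume xy: "(x, y) \<in> T" "y \<in> S"
    then have "cone y \<subseteq> cone x"
      unfolding cone_def cofinal_branches_def under_def by blast
    then show "x \<in> S"
      using xy unfolding S_def by (auto simp: Field_def)
  next
    fix c assume c: "c \<in> Field omega1"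
    let ?L = "level T (Restr omega1 (underS omega1 c))"
    show "S \<inter> ?L \<noteq> {}"
    proof
      assume disj: "S \<inter> ?L = {}"
      (* All branches through a deciding node have the same digits, so one branch per node of the
         level already yields every digit sequence that occurs. *)
      have "digits ` cofinal_branches T \<subseteq> (\<lambda>x. digits (SOME b. b \<in> cone x)) ` ?L"
      proof
        fix d assume "d \<in> digits ` cofinal_branches T"
        then obtain b where b: "b \<in> cofinal_branches T" "d = digits b" by blast
        then obtain x where x: "x \<in> b" "x \<in> ?L"
          using c unfolding cofinal_branches_def by blast
        have "b \<in> cone x"
          using b x unfolding cone_def by blast
        then have "(SOME b. b \<in> cone x) \<in> cone x"
          by (rule someI)
        moreover have "x \<in> Field T" "x \<notin> S"
          using x disj unfolding level_def by blast+
        ultimately have "d = digits (SOME b. b \<in> cone x)"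
          using \<open>b \<in> cone x\<close> b(2) unfolding S_def by blast
        then show "d \<in> (\<lambda>x. digits (SOME b. b \<in> cone x)) ` ?L"
          using x(2) by blast
      qed
      moreover have "countable ?L"
        using T c unfolding omega1_tree_def by blast
      ultimately have "countable (digits ` cofinal_branches T)"
        by (meson countable_image countable_subset)
      moreover have "digits ` cofinal_branches T
          = (\<lambda>h. restrict h (underS omega1 a)) ` cantor_space"
        unfolding surj[symmetric] digits_def by (simp add: image_image)
      ultimately show False
        using uncountable_cantor_space_restrictions[OF inf] by simp
    qed
  next
    fix b assume b: "b \<in> cofinal_branches T"
    let ?V = "{h \<in> cantor_space. \<forall>c\<in>underS omega1 a. h c = digits b c}"
    have "openin cantor_topology ?V"
      unfolding cantor_topology_def
    proof (rule topology_generated_by_Basis, intro CollectI exI[of _ a] exI[of _ "digits b"] conjI)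
      show "digits b \<in> underS omega1 a \<rightarrow>\<^sub>E (UNIV :: bool set)"
        unfolding digits_def by simp
    qed (rule refl a)+
    then have "openin (branch_topology T) {b' \<in> cofinal_branches T. f b' \<in> ?V}"
      using openin_continuous_map_preimage[OF cont] unfolding topspace_branch_topology by blast
    moreover have "b \<in> {b' \<in> cofinal_branches T. f b' \<in> ?V}"
      using b surj unfolding digits_def by auto
    ultimately have "\<exists>x\<in>b. cone x \<subseteq> {b' \<in> cofinal_branches T. f b' \<in> ?V}"
      unfolding cone_def using b by (intro openin_branch_topology_imp_cone)
    then obtain x where x: "x \<in> b"
      and "cone x \<subseteq> {b' \<in> cofinal_branches T. f b' \<in> ?V}"
      by (rule bexE)
    then have cone: "f b' \<in> ?V" if "b' \<in> cone x" for b'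
      using that by auto
    have "digits b' = digits b" if "b' \<in> cone x" for b'
      using cone[OF that] unfolding digits_def by (auto intro: restrict_ext)
    then have "x \<notin> S"
      unfolding S_def by simp
    then show "\<not> b \<subseteq> S"
      using x by blast
  qed
  then show ?thesis by blast
qed

end
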